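(* Let $\mathcal{M}_m$ be a meridian surface in $\mathbb{E}^4_2$ parametrized by $$z(u,v) = f(u)\left(\varphi(v)\cosh v\, e_1 + \varphi(v)\sinh v\, e_3 + \frac{\varphi^2(v)}{2}\,\xi_1 + \xi_2\right) + g(u)\,\xi_1,\quad u\in I,\ v\in J,$$ with the normalization $2\varepsilon f'g'=1$ on $I$. Then $\mathcal{M}_m$ is flat (its Gauss curvature vanishes identically) if and only if the meridian curve $m$ is given by $$f(u)=au+b,\qquad g(u)=\frac{\varepsilon}{2a}u+c,$$ where $a\neq0$, $b$, $c$ are constants. In this case $\mathcal{M}_m$ is a developable ruled surface.
   Context: $\mathbb{E}^4_2$ is $\mathbb{R}^4$ with the metric $\langle\cdot,\cdot\rangle$ given by $dx_1^2+dx_2^2-dx_3^2-dx_4^2$, and $e_1,e_2,e_3,e_4$ is a fixed orthonormal basis with $\langle e_1,e_1\rangle=\langle e_2,e_2\rangle=1$, $\langle e_3,e_3\rangle=\langle e_4,e_4\rangle=-1$. Put $\xi_1=\frac{e_2+e_4}{\sqrt2}$, $\xi_2=\frac{-e_2+e_4}{\sqrt2}$, so that $\langle\xi_1,\xi_1\rangle=\langle\xi_2,\xi_2\rangle=0$, $\langle\xi_1,\xi_2\rangle=-1$. Let $I,J\subset\mathbb{R}$ be open intervals, $f,g:I\to\mathbb{R}$ and $\varphi:J\to\mathbb{R}$ smooth with $f>0$. Primes denote derivatives with respect to $u$ and dots denote derivatives of $\varphi$ with respect to $v$. The surface $\mathcal{M}_m$ given by $z(u,v)$ is called a meridian surface;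 its first fundamental form has coefficients $E=-2f'g'$, $F=0$, $G=f^2(\dot\varphi^2-\varphi^2)$. Only Lorentz surfaces (induced metric of signature $(1,1)$) are considered, so it is assumed that either $\dot\varphi^2-\varphi^2>0$ on $J$ and $f'g'>0$ on $I$ (then put $\varepsilon=1$), or $\dot\varphi^2-\varphi^2<0$ on $J$ and $f'g'<0$ on $I$ (then put $\varepsilon=-1$). The parameter $u$ is normalized so that $2\varepsilon f'g'=1$. The meridian curve $m$ is the curve determined by the functions $f(u),g(u)$; the $u$-lines $v=\mathrm{const}$ of $\mathcal{M}_m$ are its (mutually congruent) copies. The Gauss curvature is $K=\dfrac{\langle h(X,X),h(Y,Y)\rangle-\langle h(X,Y),h(X,Y)\rangle}{\langle X,X\rangle\langle Y,Y\rangle-\langle X,Y\rangle^2}$ for a tangent frame $X,Y$, where $h$ is the second fundamental form. A developable ruled surface means (part of) a surface swept out by a one-parameter family of straight lines such that the tangent plane is constant along each of these lines. *)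

theory Defs
  imports "HOL-Analysis.Analysis"
begin

text \<open>
  The space \<open>real ^ 4\<close> with the metric of signature \<open>(2,2)\<close>. Note that the Euclidean inner
  product and norm of the library serve only to define derivatives.
\<close>

definition mink :: "real ^ 4 \<Rightarrow> real ^ 4 \<Rightarrow> real"
  where "mink x y = x $ 1 * y $ 1 + x $ 2 * y $ 2 - x $ 3 * y $ 3 - x $ 4 * y $ 4"

abbreviation e :: "4 \<Rightarrow> real ^ 4"
  where "e i \<equiv> axis i 1"

definition xi1 :: "real ^ 4"
  where "xi1 = (1 / sqrt 2) *\<^sub>R (e 2 + e 4)"

definition xi2 :: "real ^ 4"
  where "xi2 = (1 / sqrt 2) *\<^sub>R (- e 2 + e 4)"

definition meridian_surface ::
    "(real \<Rightarrow> real) \<Rightarrow> (real \<Rightarrow> real) \<Rightarrow> (real \<Rightarrow> real) \<Rightarrow> real \<Rightarrow> real \<Rightarrow> real ^ 4"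
  where "meridian_surface f g \<phi> u v =
    f u *\<^sub>R ((\<phi> v * cosh v) *\<^sub>R e 1 + (\<phi> v * sinh v) *\<^sub>R e 3 + ((\<phi> v)\<^sup>2 / 2) *\<^sub>R xi1 + xi2)
    + g u *\<^sub>R xi1"

text \<open>
  Infinite differentiability on an open set: there the iterated derivatives depend only on the
  values of the function on that set.
\<close>

definition smooth_on :: "(real \<Rightarrow> 'a::real_normed_vector) \<Rightarrow> real set \<Rightarrow> bool"
  where "smooth_on f S \<longleftrightarrow>
    (\<forall>n. \<forall>x\<in>S. ((\<lambda>h t. vector_derivative h (at t)) ^^ n) f differentiable (at x))"

definition du :: "(real \<Rightarrow> real \<Rightarrow> real ^ 4) \<Rightarrow> real \<Rightarrow> real \<Rightarrow> real ^ 4"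
  where "du z u v = vector_derivative (\<lambda>s. z s v) (at u)"

definition dv :: "(real \<Rightarrow> real \<Rightarrow> real ^ 4) \<Rightarrow> real \<Rightarrow> real \<Rightarrow> real ^ 4"
  where "dv z u v = vector_derivative (\<lambda>t. z u t) (at v)"

text \<open>
  A tangent vector at the point with parameters \<open>(u, v)\<close> is represented by its pair \<open>X\<close> of
  components with respect to the coordinate frame \<open>du z u v, dv z u v\<close>.
\<close>

definition tangent_vector :: "(real \<Rightarrow> real \<Rightarrow> real ^ 4) \<Rightarrow> real \<Rightarrow> real \<Rightarrow> real \<times> real \<Rightarrow> real ^ 4"
  where "tangent_vector z u v X = fst X *\<^sub>R du z u v + snd X *\<^sub>R dv z u v"

definition tangent_frame ::
    "(real \<Rightarrow> real \<Rightarrow> real ^ 4) \<Rightarrow> real \<Rightarrow> real \<Rightarrow> real \<times> real \<Rightarrow> real \<times> real \<Rightarrow> bool"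
  where "tangent_frame z u v X Y \<longleftrightarrow> dim {tangent_vector z u v X, tangent_vector z u v Y} = 2"

definition tangent_plane :: "(real \<Rightarrow> real \<Rightarrow> real ^ 4) \<Rightarrow> real \<Rightarrow> real \<Rightarrow> (real ^ 4) set"
  where "tangent_plane z u v = (\<lambda>w. z u v + w) ` span {du z u v, dv z u v}"

text \<open>
  The normal component of \<open>w\<close>; it is uniquely determined at points where the induced metric is
  nondegenerate.
\<close>

definition normal_part :: "(real \<Rightarrow> real \<Rightarrow> real ^ 4) \<Rightarrow> real \<Rightarrow> real \<Rightarrow> real ^ 4 \<Rightarrow> real ^ 4"
  where "normal_part z u v w =
    (THE n. w - n \<in> span {du z u v, dv z u v} \<and> (\<forall>x \<in> span {du z u v, dv z u v}. mink n x = 0))"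

text \<open>
  \<open>h(X, Y)\<close> is the normal component of the derivative, along \<open>X\<close>, of the tangent field extending
  \<open>Y\<close> with constant components.
\<close>

definition second_fundamental_form ::
    "(real \<Rightarrow> real \<Rightarrow> real ^ 4) \<Rightarrow> real \<Rightarrow> real \<Rightarrow> real \<times> real \<Rightarrow> real \<times> real \<Rightarrow> real ^ 4"
  where "second_fundamental_form z u v X Y = normal_part z u v
    ((fst X * fst Y) *\<^sub>R du (du z) u v + (snd X * fst Y) *\<^sub>R dv (du z) u v
     + (fst X * snd Y) *\<^sub>R du (dv z) u v + (snd X * snd Y) *\<^sub>R dv (dv z) u v)"

definition gauss_curvature ::
    "(real \<Rightarrow> real \<Rightarrow> real ^ 4) \<Rightarrow> real \<Rightarrow> real \<Rightarrow> real \<times> real \<Rightarrow> real \<times> real \<Rightarrow> real"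
  where "gauss_curvature z u v X Y =
    (let h = second_fundamental_form z u v; x = tangent_vector z u v X; y = tangent_vector z u v Y
     in (mink (h X X) (h Y Y) - mink (h X Y) (h X Y)) / (mink x x * mink y y - (mink x y)\<^sup>2))"

definition flat_on :: "(real \<Rightarrow> real \<Rightarrow> real ^ 4) \<Rightarrow> (real \<times> real) set \<Rightarrow> bool"
  where "flat_on z D \<longleftrightarrow>
    (\<forall>(u, v) \<in> D. \<forall>X Y. tangent_frame z u v X Y \<longrightarrow> gauss_curvature z u v X Y = 0)"

text \<open>
  The surface \<open>z\<close> over the parameter domain \<open>D\<close> is developable and ruled if it can be
  reparametrized as a part \<open>W\<close> of a regular surface \<open>(s, t) \<mapsto> p t + s d t\<close> that is swept out by
  the smooth family of lines \<open>{p t + s d t | s. s \<in> \<real>}\<close>, and its tangent plane is the same at all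
  points on one line. Since the linear independence condition makes the ruled parametrization an
  immersion, for an immersed smooth \<open>z\<close> the reparametrization \<open>\<psi>\<close> is a diffeomorphism as soon as
  it is a homeomorphism. The planes are compared at parameters, not at points of the image, so
  that self-intersections do no harm.
\<close>

definition developable_ruled_on :: "(real \<Rightarrow> real \<Rightarrow> real ^ 4) \<Rightarrow> (real \<times> real) set \<Rightarrow> bool"
  where "developable_ruled_on z D \<longleftrightarrow>
    (\<exists>T p d W \<psi> \<psi>'.
      open T \<and> is_interval T \<and> smooth_on p T \<and> smooth_on d T \<and> (\<forall>t\<in>T. d t \<noteq> 0) \<and>
      open W \<and> W \<subseteq> UNIV \<times> T \<and> homeomorphism W D \<psi> \<psi>' \<and>
      (\<forall>(s, t) \<in> W. (case \<psi> (s, t) of (u, v) \<Rightarrow> z u v) = p t + s *\<^sub>R d t) \<and>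
      (\<forall>(s, t) \<in> W. dim {d t, vector_derivative p (at t) + s *\<^sub>R vector_derivative d (at t)} = 2) \<and>
      (\<forall>s s' t. (s, t) \<in> W \<and> (s', t) \<in> W \<longrightarrow>
        (case \<psi> (s, t) of (u, v) \<Rightarrow> tangent_plane z u v) =
        (case \<psi> (s', t) of (u, v) \<Rightarrow> tangent_plane z u v)))"

end

theory Submission
  imports Defs
begin

text \<open>
  Put \<open>P v = \<phi> v cosh v e\<^sub>1 + \<phi> v sinh v e\<^sub>3 + (\<phi> v)\<^sup>2 / 2 \<xi>\<^sub>1 + \<xi>\<^sub>2\<close>, so that the surface is
  \<open>z u v = f u P v + g u \<xi>\<^sub>1\<close>. The curve \<open>P\<close> lies on the light cone and in the affine hyperplane
  \<open>\<langle>P, \<xi>\<^sub>1\<rangle> = -1\<close>. Differentiating these two identities gives all the scalar products that matter in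
  terms of \<open>\<kappa> = \<langle>P', P'\<rangle> = \<phi>'\<^sup>2 - \<phi>\<^sup>2\<close>, which is nowhere zero (\<open>mink_P\<close>); in particular
  \<open>\<langle>P, P''\<rangle> = - \<kappa>\<close>.

  With the normalization \<open>2 \<epsilon> f' g' = 1\<close> the first fundamental form is \<open>E = - \<epsilon>\<close>, \<open>F = 0\<close>,
  \<open>G = f\<^sup>2 \<kappa>\<close>. Since \<open>E\<close> is constant and \<open>F\<close> vanishes, \<open>z\<^sub>u\<^sub>u\<close> is already normal; \<open>z\<^sub>u\<^sub>v = (f' / f) z\<^sub>v\<close>
  is tangent, so that \<open>h(\<partial>\<^sub>u, \<partial>\<^sub>v) = 0\<close>. Therefore the numerator of the curvature in the coordinate
  frame is \<open>\<langle>z\<^sub>u\<^sub>u, z\<^sub>v\<^sub>v\<rangle> = \<langle>f'' P + g'' \<xi>\<^sub>1, f P''\<rangle> = - f f'' \<kappa>\<close>, and the curvature is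
  \<open>\<epsilon> f'' / f\<close> (\<open>gauss_curvature_eq\<close>); passing to another frame multiplies numerator and denominator
  by the same squared determinant. Hence the surface is flat exactly if \<open>f'' = 0\<close>, that is, \<open>f\<close>
  is affine with slope \<open>a \<noteq> 0\<close> on the interval, and then \<open>g' = \<epsilon> / (2 a)\<close> by the normalization
  (\<open>deriv2_zero_iff_affine\<close>).

  In that case \<open>z\<close> is affine in \<open>u\<close>, so that the \<open>u\<close>-lines are straight, with direction
  \<open>d = a P + \<epsilon> / (2 a) \<xi>\<^sub>1\<close>. The tangent plane is spanned by \<open>z\<^sub>u = d v\<close> and \<open>z\<^sub>v = f u P' v\<close>, whose
  span depends on \<open>v\<close> only (\<open>developable_ruled_if_affine\<close>).
\<close>

section \<open>Smooth functions\<close>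

text \<open>
  Coinduction spares formulas for higher derivatives: to prove a function smooth it is enough to
  put it into a class in which, on \<open>S\<close>, every member has a derivative in the class. Since \<open>S\<close> is
  open, the iterated derivatives then agree with members of the class near every point of \<open>S\<close>.
\<close>

lemma smooth_on_coinduct:
  fixes F :: "(real \<Rightarrow> 'a::real_normed_vector) set"
  assumes "open S" and "h \<in> F"
    and step: "\<And>h. h \<in> F \<Longrightarrow> \<exists>h'\<in>F. \<forall>x\<in>S. (h has_vector_derivative h' x) (at x)"
  shows "smooth_on h S"
proof -
  let ?D = "\<lambda>(h :: real \<Rightarrow> 'a) t. vector_derivative h (at t)"
  have iter: "\<exists>k\<in>F. \<forall>x\<in>S. (?D ^^ n) h x = k x" for n
  proof (induction n)
    case 0
    then show ?case using \<open>h \<in> F\<close> by auto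
  next
    case (Suc n)
    then obtain k where k: "k \<in> F" "\<And>x. x \<in> S \<Longrightarrow> k x = (?D ^^ n) h x" by force
    obtain k' where k': "k' \<in> F" "\<And>x. x \<in> S \<Longrightarrow> (k has_vector_derivative k' x) (at x)"
      using step[OF k(1)] by auto
    have "(?D ^^ Suc n) h x = k' x" if "x \<in> S" for x
    proof -
      have "((?D ^^ n) h has_vector_derivative k' x) (at x)"
        by (rule has_vector_derivative_transform_within_open[OF k'(2)])
          (use that \<open>open S\<close> k(2) in auto)
      then show ?thesis by (simp add: vector_derivative_at)
    qed
    then show ?case using k'(1) by blast
  qed
  show ?thesis unfolding smooth_on_def
  proof (intro allI ballI)
    fix n x assume "x \<in> S"
    obtain k where k: "k \<in> F" "\<And>x. x \<in> S \<Longrightarrow> k x = (?D ^^ n) h x" using iter[of n] by force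
    obtain k' where k': "(k has_vector_derivative k' x) (at x)"
      using step[OF k(1)] \<open>x \<in> S\<close> by auto
    have "((?D ^^ n) h has_vector_derivative k' x) (at x)"
      by (rule has_vector_derivative_transform_within_open[OF k'])
        (use \<open>x \<in> S\<close> \<open>open S\<close> k(2) in auto)
    then show "(?D ^^ n) h differentiable (at x)"
      by (rule differentiableI_vector)
  qed
qed

lemma smooth_on_has_vector_derivative:
  assumes "smooth_on h S" "x \<in> S"
  shows "(h has_vector_derivative vector_derivative h (at x)) (at x)"
proof -
  have "((\<lambda>h t. vector_derivative h (at t)) ^^ 0) h differentiable (at x)"
    using assms unfolding smooth_on_def by blast
  then show ?thesis by (simp add: vector_derivative_works)
qed

lemma smooth_on_vector_derivative:
  assumes "smooth_on h S"
  shows "smooth_on (\<lambda>t. vector_derivative h (at t)) S"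
  unfolding smooth_on_def
proof (intro allI ballI)
  fix n x assume "x \<in> S"
  with assms have "((\<lambda>h t. vector_derivative h (at t)) ^^ Suc n) h differentiable (at x)"
    unfolding smooth_on_def by blast
  then show "((\<lambda>h t. vector_derivative h (at t)) ^^ n)
      (\<lambda>t. vector_derivative h (at t)) differentiable (at x)"
    by (simp only: funpow_Suc_right o_apply)
qed

lemma vector_derivative_cong_on_open:
  assumes "open S" "x \<in> S" "\<And>t. t \<in> S \<Longrightarrow> h t = k t" "(k has_vector_derivative k') (at x)"
  shows "vector_derivative h (at x) = k'"
  using has_vector_derivative_transform_within_open[OF assms(4,1,2)] assms(3)
  by (metis vector_derivative_at)

lemma smooth_on_const: "open S \<Longrightarrow> smooth_on (\<lambda>t. c) S"
proof (rule smooth_on_coinduct[where F = "range (\<lambda>c t. c)"])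
  fix h :: "real \<Rightarrow> 'a" assume "h \<in> range (\<lambda>c t. c)"
  then show "\<exists>h'\<in>range (\<lambda>c t. c). \<forall>x\<in>S. (h has_vector_derivative h' x) (at x)"
    by (intro bexI[of _ "\<lambda>t. 0"]) (auto simp: has_vector_derivative_const)
qed auto

text \<open>
  Products alone are not closed under differentiation; their sums are, by the product rule.
\<close>

inductive_set sums_of_smooth_products :: "real set \<Rightarrow> (real \<Rightarrow> 'a::real_normed_vector) set"
  for S where
    product: "smooth_on h S \<Longrightarrow> smooth_on k S \<Longrightarrow>
      (\<lambda>t. h t *\<^sub>R k t) \<in> sums_of_smooth_products S"
  | sum: "h \<in> sums_of_smooth_products S \<Longrightarrow> k \<in> sums_of_smooth_products S \<Longrightarrow>
      (\<lambda>t. h t + k t) \<in> sums_of_smooth_products S"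

lemma smooth_on_sums_of_smooth_products:
  fixes l :: "real \<Rightarrow> 'a::real_normed_vector"
  assumes "open S" "l \<in> sums_of_smooth_products S"
  shows "smooth_on l S"
proof (rule smooth_on_coinduct[OF assms])
  fix l :: "real \<Rightarrow> 'a" assume "l \<in> sums_of_smooth_products S"
  then show "\<exists>l'\<in>sums_of_smooth_products S. \<forall>x\<in>S. (l has_vector_derivative l' x) (at x)"
  proof induction
    case (product h k)
    let ?l' = "\<lambda>t. h t *\<^sub>R vector_derivative k (at t) + vector_derivative h (at t) *\<^sub>R k t"
    have "?l' \<in> sums_of_smooth_products S"
      by (intro sums_of_smooth_products.intros smooth_on_vector_derivative product)
    moreover have "((\<lambda>t. h t *\<^sub>R k t) has_vector_derivative ?l' x) (at x)" if "x \<in> S" for x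
      using smooth_on_has_vector_derivative[OF product(1) that]
        smooth_on_has_vector_derivative[OF product(2) that]
      by (intro has_vector_derivative_scaleR)
        (simp_all add: has_real_derivative_iff_has_vector_derivative)
    ultimately show ?case by (intro bexI[of _ ?l'] ballI)
  next
    case (sum h k)
    then obtain h' k' where "h' \<in> sums_of_smooth_products S" "k' \<in> sums_of_smooth_products S"
      and "\<forall>x\<in>S. (h has_vector_derivative h' x) (at x)"
      and "\<forall>x\<in>S. (k has_vector_derivative k' x) (at x)" by blast
    then show ?case
      by (intro bexI[of _ "\<lambda>t. h' t + k' t"])
        (auto intro: has_vector_derivative_add sums_of_smooth_products.sum)
  qed
qed

lemma smooth_on_scaleR:
  assumes "open S" "smooth_on h S" "smooth_on k S"
  shows "smooth_on (\<lambda>t. h t *\<^sub>R k t) S"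
  by (intro smooth_on_sums_of_smooth_products sums_of_smooth_products.product assms)

lemma smooth_on_add:
  assumes "open S" "smooth_on h S" "smooth_on k S"
  shows "smooth_on (\<lambda>t. h t + k t) S"
proof -
  \<comment> \<open>Each summand counts as a product with the constant function 1.\<close>
  have "(\<lambda>t. 1 *\<^sub>R h t + 1 *\<^sub>R k t) \<in> sums_of_smooth_products S"
    by (intro sums_of_smooth_products.intros smooth_on_const assms)
  from smooth_on_sums_of_smooth_products[OF assms(1) this] show ?thesis by simp
qed

lemma smooth_on_mult:
  fixes h k :: "real \<Rightarrow> real"
  assumes "open S" "smooth_on h S" "smooth_on k S"
  shows "smooth_on (\<lambda>t. h t * k t) S"
  using smooth_on_scaleR[OF assms] by simp

lemma smooth_on_cosh_sinh:
  assumes "open S"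
  shows "smooth_on (cosh :: real \<Rightarrow> real) S" "smooth_on (sinh :: real \<Rightarrow> real) S"
proof -
  have "(cosh has_vector_derivative sinh x) (at x)" "(sinh has_vector_derivative cosh x) (at x)"
    for x :: real
    by (auto simp flip: has_real_derivative_iff_has_vector_derivative intro!: derivative_eq_intros)
  then have "\<exists>h'\<in>{cosh, sinh}. \<forall>x\<in>S. (h has_vector_derivative h' x) (at x)"
    if "h \<in> {cosh, sinh}" for h :: "real \<Rightarrow> real"
    using that by auto
  then show "smooth_on (cosh :: real \<Rightarrow> real) S" "smooth_on (sinh :: real \<Rightarrow> real) S"
    using smooth_on_coinduct[OF assms, of _ "{cosh, sinh}"] by blast+
qed

lemma smooth_on_deriv:
  fixes h :: "real \<Rightarrow> real"
  assumes "smooth_on h S"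
  shows "smooth_on (deriv h) S" and "x \<in> S \<Longrightarrow> (h has_real_derivative deriv h x) (at x)"
proof -
  have "deriv h = (\<lambda>t. vector_derivative h (at t))"
    by (simp add: fun_eq_iff field_derivative_eq_vector_derivative)
  then show "smooth_on (deriv h) S" and "x \<in> S \<Longrightarrow> (h has_real_derivative deriv h x) (at x)"
    using assms smooth_on_vector_derivative smooth_on_has_vector_derivative
    by (simp_all add: has_real_derivative_iff_has_vector_derivative)
qed

lemma affine_on_interval:
  fixes h :: "real \<Rightarrow> real"
  assumes "is_interval S" and h: "\<And>x. x \<in> S \<Longrightarrow> (h has_real_derivative a) (at x)"
  obtains b where "\<And>x. x \<in> S \<Longrightarrow> h x = a * x + b"
proof -
  have "\<exists>c. \<forall>x\<in>S. h x - a * x = c"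
  proof (rule has_field_derivative_zero_constant)
    show "convex S" using assms(1) by (simp add: is_interval_convex)
    fix x assume "x \<in> S"
    then have "((\<lambda>x. h x - a * x) has_real_derivative 0) (at x)"
      using h by (auto intro!: derivative_eq_intros)
    then show "((\<lambda>x. h x - a * x) has_real_derivative 0) (at x within S)"
      by (rule has_field_derivative_at_within)
  qed
  then show ?thesis using that by (force simp: algebra_simps)
qed

lemma deriv_affine_on_open:
  fixes h :: "real \<Rightarrow> real"
  assumes "open S" "x \<in> S" and h: "\<And>x. x \<in> S \<Longrightarrow> h x = a * x + b"
  shows "deriv h x = a"
proof (rule DERIV_imp_deriv)
  have "((\<lambda>x. a * x + b) has_real_derivative a) (at x)" by (auto intro!: derivative_eq_intros)
  then show "(h has_real_derivative a) (at x)"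
    by (rule has_field_derivative_transform_within_open[OF _ assms(1,2)]) (simp add: h)
qed

section \<open>The neutral scalar product and normal components\<close>

lemma mink_linear [simp]:
  "mink (x + y) w = mink x w + mink y w" "mink w (x + y) = mink w x + mink w y"
  "mink (x - y) w = mink x w - mink y w" "mink w (x - y) = mink w x - mink w y"
  "mink (r *\<^sub>R x) w = r * mink x w" "mink w (r *\<^sub>R x) = r * mink w x"
  "mink 0 w = 0" "mink w 0 = 0"
  by (simp_all add: mink_def algebra_simps)

lemma mink_commute: "mink x y = mink y x"
  by (simp add: mink_def algebra_simps)

lemma has_real_derivative_mink:
  assumes "(p has_vector_derivative p') (at t)" "(q has_vector_derivative q') (at t)"
  shows "((\<lambda>t. mink (p t) (q t)) has_real_derivative mink p' (q t) + mink (p t) q') (at t)"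
proof -
  have [derivative_intros]: "((\<lambda>t. p t $ i) has_real_derivative p' $ i) (at t)"
      "((\<lambda>t. q t $ i) has_real_derivative q' $ i) (at t)" for i
    using assms bounded_linear.has_vector_derivative[OF bounded_linear_vec_nth]
    by (auto simp: has_real_derivative_iff_has_vector_derivative)
  show ?thesis
    unfolding mink_def by (auto intro!: derivative_eq_intros simp: algebra_simps)
qed

text \<open>
  A polarized form of the fact that a curve on a quadric is orthogonal to its velocity. It turns
  the identities that define the light cone curve below into scalar products of its derivatives.
\<close>

lemma mink_derivative_of_constant:
  assumes "open S" "t \<in> S" "\<And>s. s \<in> S \<Longrightarrow> mink (p s) (q s) = c"
    and "(p has_vector_derivative p') (at t)" "(q has_vector_derivative q') (at t)"
  shows "mink p' (q t) + mink (p t) q' = 0"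
proof (rule DERIV_unique)
  show "((\<lambda>s. c) has_real_derivative mink p' (q t) + mink (p t) q') (at t)"
    by (rule has_field_derivative_transform_within_open
        [OF has_real_derivative_mink[OF assms(4,5)] assms(1,2)]) (use assms(3) in auto)
qed simp

lemma dim_two_iff:
  fixes x y :: "'a::euclidean_space"
  shows "dim {x, y} = 2 \<longleftrightarrow> (\<forall>a b. a *\<^sub>R x + b *\<^sub>R y = 0 \<longrightarrow> a = 0 \<and> b = 0)"
proof
  assume d: "dim {x, y} = 2"
  have dy: "dim {y} \<le> 1" by (simp add: dim_singleton)
  have x: "x \<notin> span {y}" using d dy by (auto simp: dim_insert split: if_splits)
  have "y \<noteq> 0"
    using d x by (auto simp: dim_insert)
  show "\<forall>a b. a *\<^sub>R x + b *\<^sub>R y = 0 \<longrightarrow> a = 0 \<and> b = 0"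
  proof (intro allI impI)
    fix a b assume ab: "a *\<^sub>R x + b *\<^sub>R y = 0"
    have "a = 0"
    proof (rule ccontr)
      assume "a \<noteq> 0"
      have "a *\<^sub>R x = (- b) *\<^sub>R y" using ab by (simp add: eq_neg_iff_add_eq_0)
      then have "inverse a *\<^sub>R (a *\<^sub>R x) = inverse a *\<^sub>R ((- b) *\<^sub>R y)" by (rule arg_cong)
      then have "x = (- b / a) *\<^sub>R y" using \<open>a \<noteq> 0\<close> by (simp add: divide_inverse mult.commute)
      with x show False by (metis span_singleton rangeI)
    qed
    with ab \<open>y \<noteq> 0\<close> show "a = 0 \<and> b = 0" by simp
  qed
next
  assume *: "\<forall>a b. a *\<^sub>R x + b *\<^sub>R y = 0 \<longrightarrow> a = 0 \<and> b = 0"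
  have "y \<noteq> 0" using *[rule_format, of 0 1] by auto
  moreover have "x \<notin> span {y}"
  proof
    assume "x \<in> span {y}"
    then obtain k where "x = k *\<^sub>R y" by (auto simp: span_singleton)
    then show False using *[rule_format, of 1 "- k"] by auto
  qed
  ultimately show "dim {x, y} = 2" by (simp add: dim_insert)
qed

text \<open>
  In an indefinite metric orthogonality does not give independence; for vectors that are not
  lightlike it does, by pairing a vanishing combination with each of them.
\<close>

lemma dim_two_if_orthogonal:
  assumes "mink x x \<noteq> 0" "mink y y \<noteq> 0" "mink x y = 0"
  shows "dim {x, y} = 2"
  unfolding dim_two_iff
proof (intro allI impI)
  fix a b assume "a *\<^sub>R x + b *\<^sub>R y = 0"
  then have "mink (a *\<^sub>R x + b *\<^sub>R y) x = 0" "mink (a *\<^sub>R x + b *\<^sub>R y) y = 0" by simp_all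
  then show "a = 0 \<and> b = 0" using assms by (simp add: mink_commute[of y x])
qed

lemma translation_of_span:
  fixes x :: "'a::real_vector"
  assumes "x \<in> span S"
  shows "(\<lambda>w. x + w) ` span S = span S"
proof
  show "span S \<subseteq> (\<lambda>w. x + w) ` span S"
  proof
    fix y assume "y \<in> span S"
    then show "y \<in> (\<lambda>w. x + w) ` span S"
      using assms by (intro image_eqI[of _ _ "y - x"]) (auto intro: span_diff)
  qed
qed (use assms in \<open>auto intro: span_add\<close>)

lemma in_span_pair_iff: "w \<in> span {x, y} \<longleftrightarrow> (\<exists>a b. w = a *\<^sub>R x + b *\<^sub>R y)"
  by (auto simp: span_insert span_singleton algebra_simps)

text \<open>
  A vector that is both tangent and normal vanishes, because the coordinate frame is orthogonal and
  not lightlike. So the description that defines \<open>normal_part\<close> determines at most one vector, and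
  any decomposition into a normal and a tangent vector exhibits it.
\<close>

lemma normal_part_eqI:
  assumes A: "mink (du z u v) (du z u v) \<noteq> 0" and B: "mink (dv z u v) (dv z u v) \<noteq> 0"
    and AB: "mink (du z u v) (dv z u v) = 0"
    and n: "mink n (du z u v) = 0" "mink n (dv z u v) = 0"
    and w: "w = n + \<alpha> *\<^sub>R du z u v + \<beta> *\<^sub>R dv z u v"
  shows "normal_part z u v w = n"
  unfolding normal_part_def
proof (rule the_equality)
  let ?A = "du z u v" and ?B = "dv z u v"
  show "w - n \<in> span {?A, ?B} \<and> (\<forall>x\<in>span {?A, ?B}. mink n x = 0)"
    using w n by (auto simp: in_span_pair_iff)
  fix m assume m: "w - m \<in> span {?A, ?B} \<and> (\<forall>x\<in>span {?A, ?B}. mink m x = 0)"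
  have mA: "mink m ?A = 0" "mink m ?B = 0" using m by (auto simp: span_base)
  obtain a b where ab: "w - m = a *\<^sub>R ?A + b *\<^sub>R ?B" using m by (auto simp: in_span_pair_iff)
  have eq: "m - n = (\<alpha> - a) *\<^sub>R ?A + (\<beta> - b) *\<^sub>R ?B"
    using w ab by (simp add: algebra_simps)
  have "mink (m - n) ?A = 0" "mink (m - n) ?B = 0" using mA n by simp_all
  then have "\<alpha> - a = 0" "\<beta> - b = 0"
    unfolding eq using A B AB by (simp_all add: mink_commute[of ?B ?A])
  with eq show "m = n" by simp
qed

section \<open>The light cone curve\<close>

definition cone_curve :: "(real \<Rightarrow> real) \<Rightarrow> real \<Rightarrow> real ^ 4"
  where "cone_curve \<phi> v =
    (\<phi> v * cosh v) *\<^sub>R e 1 + (\<phi> v * sinh v) *\<^sub>R e 3 + ((\<phi> v)\<^sup>2 / 2) *\<^sub>R xi1 + xi2"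

lemma meridian_surface_eq:
  "meridian_surface f g \<phi> u v = f u *\<^sub>R cone_curve \<phi> v + g u *\<^sub>R xi1"
  by (simp add: meridian_surface_def cone_curve_def)

lemma mink_frame:
  "mink xi1 xi1 = 0" "mink xi2 xi2 = 0" "mink xi1 xi2 = -1" "mink xi2 xi1 = -1"
  "mink (e 1) (e 1) = 1" "mink (e 3) (e 3) = -1" "mink (e 1) (e 3) = 0" "mink (e 3) (e 1) = 0"
  "mink (e 1) xi1 = 0" "mink xi1 (e 1) = 0" "mink (e 1) xi2 = 0" "mink xi2 (e 1) = 0"
  "mink (e 3) xi1 = 0" "mink xi1 (e 3) = 0" "mink (e 3) xi2 = 0" "mink xi2 (e 3) = 0"
  by (simp_all add: mink_def xi1_def xi2_def axis_def)

lemma mink_cone_curve: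
  "mink (cone_curve \<phi> v) (cone_curve \<phi> v) = 0" "mink (cone_curve \<phi> v) xi1 = -1"
proof -
  have "mink (cone_curve \<phi> v) (cone_curve \<phi> v) = (\<phi> v)\<^sup>2 * ((cosh v)\<^sup>2 - (sinh v)\<^sup>2 - 1)"
    by (simp add: cone_curve_def mink_frame power2_eq_square algebra_simps)
  then show "mink (cone_curve \<phi> v) (cone_curve \<phi> v) = 0" by (simp add: hyperbolic_pythagoras)
  show "mink (cone_curve \<phi> v) xi1 = -1" by (simp add: cone_curve_def mink_frame)
qed

lemma cone_curve_has_vector_derivative:
  assumes "(\<phi> has_real_derivative d) (at v)"
  shows "(cone_curve \<phi> has_vector_derivative
    (d * cosh v + \<phi> v * sinh v) *\<^sub>R e 1 + (d * sinh v + \<phi> v * cosh v) *\<^sub>R e 3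
    + (\<phi> v * d) *\<^sub>R xi1) (at v)"
  unfolding cone_curve_def[abs_def]
  using assms
  by (auto intro!: derivative_eq_intros simp: algebra_simps)

lemma mink_cone_curve_velocity:
  assumes "(\<phi> has_real_derivative d) (at v)"
  shows "mink (vector_derivative (cone_curve \<phi>) (at v)) (vector_derivative (cone_curve \<phi>) (at v))
    = d\<^sup>2 - (\<phi> v)\<^sup>2"
proof -
  have "mink (vector_derivative (cone_curve \<phi>) (at v)) (vector_derivative (cone_curve \<phi>) (at v))
    = (d\<^sup>2 - (\<phi> v)\<^sup>2) * ((cosh v)\<^sup>2 - (sinh v)\<^sup>2)"
    unfolding vector_derivative_at[OF cone_curve_has_vector_derivative[OF assms]]
    by (simp add: mink_frame power2_eq_square algebra_simps)
  then show ?thesis by (simp add: hyperbolic_pythagoras)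
qed

lemma smooth_on_cone_curve:
  assumes "open S" "smooth_on \<phi> S"
  shows "smooth_on (cone_curve \<phi>) S"
proof -
  note intros = smooth_on_add[OF \<open>open S\<close>] smooth_on_scaleR[OF \<open>open S\<close>] smooth_on_mult[OF \<open>open S\<close>]
    smooth_on_const[OF \<open>open S\<close>] smooth_on_cosh_sinh[OF \<open>open S\<close>] \<open>smooth_on \<phi> S\<close>
  have "smooth_on (\<lambda>v. (\<phi> v * cosh v) *\<^sub>R e 1 + (\<phi> v * sinh v) *\<^sub>R e 3
      + ((\<phi> v * \<phi> v) * (1 / 2)) *\<^sub>R xi1 + xi2) S"
    by (rule intros)+
  moreover have "cone_curve \<phi> = (\<lambda>v. (\<phi> v * cosh v) *\<^sub>R e 1 + (\<phi> v * sinh v) *\<^sub>R e 3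
      + ((\<phi> v * \<phi> v) * (1 / 2)) *\<^sub>R xi1 + xi2)"
    by (simp add: fun_eq_iff cone_curve_def power2_eq_square)
  ultimately show ?thesis by simp
qed

section \<open>Curvature of a Lorentz meridian surface\<close>

text \<open>
  The two causal types of the surface are treated at once, through \<open>\<epsilon>\<^sup>2 = 1\<close> and a function \<open>\<phi>'\<^sup>2 - \<phi>\<^sup>2\<close>
  without zeros. The induced metric is then nondegenerate.
\<close>

locale lorentz_meridian_surface =
  fixes f g \<phi> :: "real \<Rightarrow> real" and I J :: "real set" and \<epsilon> :: real
  assumes open_I: "open I" and open_J: "open J"
    and smooth_f: "smooth_on f I" and smooth_g: "smooth_on g I" and smooth_\<phi>: "smooth_on \<phi> J"
    and f_pos: "\<And>u. u \<in> I \<Longrightarrow> f u > 0"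
    and eps: "\<epsilon> * \<epsilon> = 1"
    and nonlightlike: "\<And>v. v \<in> J \<Longrightarrow> (deriv \<phi> v)\<^sup>2 - (\<phi> v)\<^sup>2 \<noteq> 0"
    and normalized: "\<And>u. u \<in> I \<Longrightarrow> 2 * \<epsilon> * deriv f u * deriv g u = 1"
begin

abbreviation z :: "real \<Rightarrow> real \<Rightarrow> real ^ 4"
  where "z \<equiv> meridian_surface f g \<phi>"

abbreviation P :: "real \<Rightarrow> real ^ 4"
  where "P \<equiv> cone_curve \<phi>"

abbreviation P' :: "real \<Rightarrow> real ^ 4"
  where "P' v \<equiv> vector_derivative P (at v)"

abbreviation P'' :: "real \<Rightarrow> real ^ 4"
  where "P'' v \<equiv> vector_derivative P' (at v)"

abbreviation \<kappa> :: "real \<Rightarrow> real"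
  where "\<kappa> v \<equiv> (deriv \<phi> v)\<^sup>2 - (\<phi> v)\<^sup>2"

lemma derivs:
  "u \<in> I \<Longrightarrow> (f has_real_derivative deriv f u) (at u)"
  "u \<in> I \<Longrightarrow> (g has_real_derivative deriv g u) (at u)"
  "u \<in> I \<Longrightarrow> (deriv f has_real_derivative deriv (deriv f) u) (at u)"
  "u \<in> I \<Longrightarrow> (deriv g has_real_derivative deriv (deriv g) u) (at u)"
  "v \<in> J \<Longrightarrow> (P has_vector_derivative P' v) (at v)"
  "v \<in> J \<Longrightarrow> (P' has_vector_derivative P'' v) (at v)"
  by (rule smooth_on_deriv(2)[OF smooth_f] smooth_on_deriv(2)[OF smooth_g]
      smooth_on_deriv(2)[OF smooth_on_deriv(1)[OF smooth_f]]
      smooth_on_deriv(2)[OF smooth_on_deriv(1)[OF smooth_g]]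
      smooth_on_has_vector_derivative[OF smooth_on_cone_curve[OF open_J smooth_\<phi>]]
      smooth_on_has_vector_derivative[OF smooth_on_vector_derivative[OF
        smooth_on_cone_curve[OF open_J smooth_\<phi>]]]; assumption)+

text \<open>
  Differentiating \<open>\<langle>P, P\<rangle> = 0\<close> twice and \<open>\<langle>P, \<xi>\<^sub>1\<rangle> = -1\<close> twice leaves only \<open>\<langle>P', P'\<rangle>\<close> to be computed from
  the coordinates of \<open>P\<close>.
\<close>

lemma mink_P:
  assumes "v \<in> J"
  shows "mink (P v) (P' v) = 0" "mink (P' v) (P' v) = \<kappa> v" "mink (P v) (P'' v) = - \<kappa> v"
    and "mink xi1 (P' v) = 0" "mink xi1 (P'' v) = 0"
proof -
  note const = mink_derivative_of_constant[OF open_J]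
  have PP': "mink (P v) (P' v) = 0" if "v \<in> J" for v
    using const[OF that mink_cone_curve(1) derivs(5)[OF that] derivs(5)[OF that]]
    by (simp add: mink_commute[of "P' v"])
  have xP': "mink (P' v) xi1 = 0" if "v \<in> J" for v
    using const[OF that mink_cone_curve(2) derivs(5)[OF that] has_vector_derivative_const] by simp
  show P'P': "mink (P' v) (P' v) = \<kappa> v"
    using mink_cone_curve_velocity smooth_on_deriv(2)[OF smooth_\<phi> assms] .
  show "mink (P v) (P'' v) = - \<kappa> v"
    using const[OF assms PP' derivs(5)[OF assms] derivs(6)[OF assms]] P'P' by simp
  show "mink xi1 (P'' v) = 0"
    using const[OF assms xP' derivs(6)[OF assms] has_vector_derivative_const]
    by (simp add: mink_commute)
  show "mink (P v) (P' v) = 0" "mink xi1 (P' v) = 0"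
    using PP' xP' assms by (simp_all add: mink_commute)
qed

lemma first_partials:
  "u \<in> I \<Longrightarrow> du z u v = deriv f u *\<^sub>R P v + deriv g u *\<^sub>R xi1"
  "v \<in> J \<Longrightarrow> dv z u v = f u *\<^sub>R P' v"
  unfolding du_def dv_def meridian_surface_eq
  using derivs(1,2)[of u] derivs(5)[of v]
  by (auto intro!: vector_derivative_at derivative_eq_intros)

lemma second_partials:
  assumes "u \<in> I" "v \<in> J"
  shows "du (du z) u v = deriv (deriv f) u *\<^sub>R P v + deriv (deriv g) u *\<^sub>R xi1"
    and "dv (du z) u v = deriv f u *\<^sub>R P' v"
    and "du (dv z) u v = deriv f u *\<^sub>R P' v"
    and "dv (dv z) u v = f u *\<^sub>R P'' v"
proof -
  show "du (du z) u v = deriv (deriv f) u *\<^sub>R P v + deriv (deriv g) u *\<^sub>R xi1"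
    unfolding du_def[of "du z"] using derivs(1-4)[OF \<open>u \<in> I\<close>] derivs(5,6)[OF \<open>v \<in> J\<close>]
    by (intro vector_derivative_cong_on_open[OF open_I \<open>u \<in> I\<close> first_partials(1)])
      (auto intro!: derivative_eq_intros)
  show "dv (du z) u v = deriv f u *\<^sub>R P' v"
    unfolding dv_def[of "du z"] first_partials(1)[OF \<open>u \<in> I\<close>] using derivs(1-4)[OF \<open>u \<in> I\<close>] derivs(5,6)[OF \<open>v \<in> J\<close>]
    by (intro vector_derivative_at) (auto intro!: derivative_eq_intros)
  show "du (dv z) u v = deriv f u *\<^sub>R P' v"
    unfolding du_def[of "dv z"] first_partials(2)[OF \<open>v \<in> J\<close>] using derivs(1-4)[OF \<open>u \<in> I\<close>] derivs(5,6)[OF \<open>v \<in> J\<close>]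
    by (intro vector_derivative_at) (auto intro!: derivative_eq_intros)
  show "dv (dv z) u v = f u *\<^sub>R P'' v"
    unfolding dv_def[of "dv z"] using derivs(1-4)[OF \<open>u \<in> I\<close>] derivs(5,6)[OF \<open>v \<in> J\<close>]
    by (intro vector_derivative_cong_on_open[OF open_J \<open>v \<in> J\<close> first_partials(2)])
      (auto intro!: derivative_eq_intros)
qed

text \<open>
  The derivative of the normalization. It says that \<open>z\<^sub>u\<^sub>u\<close> is orthogonal to \<open>z\<^sub>u\<close>.
\<close>

lemma normalized_derivative:
  assumes "u \<in> I"
  shows "deriv (deriv f) u * deriv g u + deriv f u * deriv (deriv g) u = 0"
proof (rule DERIV_unique)
  have "((\<lambda>u. deriv f u * deriv g u) has_real_derivative
      deriv (deriv f) u * deriv g u + deriv f u * deriv (deriv g) u) (at u)"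
    using derivs(3,4)[OF assms] by (auto intro!: derivative_eq_intros)
  moreover have "deriv f t * deriv g t = \<epsilon> / 2" if "t \<in> I" for t
  proof -
    have "deriv f t * deriv g t = \<epsilon> * \<epsilon> * (deriv f t * deriv g t)" using eps by simp
    also have "\<dots> = \<epsilon> / 2" using normalized[OF that] by (simp add: algebra_simps)
    finally show ?thesis .
  qed
  ultimately show "((\<lambda>t. \<epsilon> / 2) has_real_derivative
      deriv (deriv f) u * deriv g u + deriv f u * deriv (deriv g) u) (at u)"
    by (rule has_field_derivative_transform_within_open[OF _ open_I assms])
qed simp

lemma first_fundamental_form:
  assumes "u \<in> I" "v \<in> J"
  shows "mink (du z u v) (du z u v) = - \<epsilon>" "mink (du z u v) (dv z u v) = 0"
    "mink (dv z u v) (dv z u v) = (f u)\<^sup>2 * \<kappa> v"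
proof -
  have "- 2 * deriv f u * deriv g u = - \<epsilon> * \<epsilon> * 2 * deriv f u * deriv g u" using eps by simp
  also have "\<dots> = - \<epsilon>" using normalized[OF assms(1)] by (simp add: algebra_simps)
  finally show "mink (du z u v) (du z u v) = - \<epsilon>"
    using first_partials assms
    by (simp add: mink_cone_curve mink_frame mink_commute[of xi1 "P v"] algebra_simps)
  show "mink (du z u v) (dv z u v) = 0" "mink (dv z u v) (dv z u v) = (f u)\<^sup>2 * \<kappa> v"
    using first_partials assms by (simp_all add: mink_P power2_eq_square)
qed

lemma first_fundamental_form_nonzero:
  assumes "u \<in> I" "v \<in> J"
  shows "mink (du z u v) (du z u v) \<noteq> 0" "mink (dv z u v) (dv z u v) \<noteq> 0"
  using first_fundamental_form[OF assms] eps nonlightlike[OF assms(2)] f_pos[OF assms(1)] by auto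

lemma dim_partials: "u \<in> I \<Longrightarrow> v \<in> J \<Longrightarrow> dim {du z u v, dv z u v} = 2"
  by (intro dim_two_if_orthogonal first_fundamental_form_nonzero first_fundamental_form)

text \<open>
  In the coordinate frame \<open>h\<close> is diagonal, with entries \<open>n1 = z\<^sub>u\<^sub>u\<close> and \<open>n2\<close>, the normal part of
  \<open>z\<^sub>v\<^sub>v\<close>. Since \<open>n1\<close> is normal, \<open>\<langle>n1, n2\<rangle> = \<langle>z\<^sub>u\<^sub>u, z\<^sub>v\<^sub>v\<rangle>\<close>, and \<open>n2\<close> need not be computed.
\<close>

lemma gauss_curvature_eq:
  assumes "u \<in> I" "v \<in> J" and frame: "tangent_frame z u v X Y"
  shows "gauss_curvature z u v X Y = \<epsilon> * deriv (deriv f) u / f u"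
proof -
  let ?A = "du z u v" and ?B = "dv z u v" and ?\<kappa> = "\<kappa> v"
  note ff = first_fundamental_form[OF assms(1,2)]
  note ff0 = first_fundamental_form_nonzero[OF assms(1,2)]
  note partials = first_partials(1)[OF assms(1)] first_partials(2)[OF assms(2)]
  define n1 where "n1 = du (du z) u v"
  define w where "w = dv (dv z) u v"
  \<comment> \<open>Orthogonal projection of \<open>z\<^sub>v\<^sub>v\<close>; the divisors are \<open>E\<close> and \<open>G\<close>.\<close>
  define \<alpha> where "\<alpha> = mink w ?A / mink ?A ?A"
  define \<beta> where "\<beta> = mink w ?B / mink ?B ?B"
  define n2 where "n2 = w - \<alpha> *\<^sub>R ?A - \<beta> *\<^sub>R ?B"
  have n1: "mink n1 ?A = 0" "mink n1 ?B = 0"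
    using normalized_derivative[OF assms(1)] assms(2)
    unfolding n1_def second_partials[OF assms(1,2)] partials
    by (simp_all add: mink_P mink_cone_curve mink_frame mink_commute[of xi1 "P v"] algebra_simps)
  have n2: "mink n2 ?A = 0" "mink n2 ?B = 0"
    unfolding n2_def \<alpha>_def \<beta>_def using ff0 ff(2) by (simp_all add: mink_commute[of ?B ?A])
  have n12: "mink n1 n2 = - f u * deriv (deriv f) u * ?\<kappa>"
  proof -
    have "mink n1 n2 = mink n1 w" unfolding n2_def using n1 by simp
    also have "\<dots> = - f u * deriv (deriv f) u * ?\<kappa>"
      unfolding n1_def w_def second_partials[OF assms(1,2)]
      using assms(2) by (simp add: mink_P algebra_simps)
    finally show ?thesis .
  qed
  have h: "second_fundamental_form z u v X Y =
      (fst X * fst Y) *\<^sub>R n1 + (snd X * snd Y) *\<^sub>R n2" for X Y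
    unfolding second_fundamental_form_def
  proof (rule normal_part_eqI[OF ff0 ff(2)])
    have mixed: "dv (du z) u v = (deriv f u / f u) *\<^sub>R ?B" "du (dv z) u v = (deriv f u / f u) *\<^sub>R ?B"
      using second_partials[OF assms(1,2)] partials(2) f_pos[OF assms(1)] by simp_all
    show "(fst X * fst Y) *\<^sub>R du (du z) u v + (snd X * fst Y) *\<^sub>R dv (du z) u v
        + (fst X * snd Y) *\<^sub>R du (dv z) u v + (snd X * snd Y) *\<^sub>R dv (dv z) u v
      = (fst X * fst Y) *\<^sub>R n1 + (snd X * snd Y) *\<^sub>R n2 + (snd X * snd Y * \<alpha>) *\<^sub>R ?A
        + ((snd X * fst Y + fst X * snd Y) * (deriv f u / f u) + snd X * snd Y * \<beta>) *\<^sub>R ?B"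
      unfolding mixed n2_def by (simp add: n1_def w_def algebra_simps)
  qed (use n1 n2 in simp_all)
  let ?det = "fst X * snd Y - snd X * fst Y"
  \<comment> \<open>By Cramer's rule, a vanishing determinant would give a linear relation between the vectors of
    the frame, whose coefficients are components of the vectors themselves.\<close>
  have "?det \<noteq> 0"
  proof
    assume det: "?det = 0"
    let ?x = "tangent_vector z u v X" and ?y = "tangent_vector z u v Y"
    have indep: "a = 0 \<and> b = 0" if "a *\<^sub>R ?x + b *\<^sub>R ?y = 0" for a b
      using frame that unfolding tangent_frame_def dim_two_iff by blast
    have "snd Y *\<^sub>R ?x + (- snd X) *\<^sub>R ?y = ?det *\<^sub>R ?A"
      "fst Y *\<^sub>R ?x + (- fst X) *\<^sub>R ?y = (- ?det) *\<^sub>R ?B"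
      by (simp_all add: tangent_vector_def algebra_simps)
    then have "snd Y *\<^sub>R ?x + (- snd X) *\<^sub>R ?y = 0" "fst Y *\<^sub>R ?x + (- fst X) *\<^sub>R ?y = 0"
      unfolding det by simp_all
    then have "snd X = 0" "fst X = 0" using indep by (metis neg_equal_0_iff_equal)+
    then have "1 *\<^sub>R ?x + 0 *\<^sub>R ?y = 0" by (simp add: tangent_vector_def)
    then show False using indep zero_neq_one by metis
  qed
  have num: "mink (second_fundamental_form z u v X X) (second_fundamental_form z u v Y Y)
      - mink (second_fundamental_form z u v X Y) (second_fundamental_form z u v X Y)
      = ?det\<^sup>2 * mink n1 n2"
    unfolding h by (simp add: mink_commute[of n2 n1] power2_eq_square algebra_simps)
  have den: "mink (tangent_vector z u v X) (tangent_vector z u v X)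
        * mink (tangent_vector z u v Y) (tangent_vector z u v Y)
      - (mink (tangent_vector z u v X) (tangent_vector z u v Y))\<^sup>2
      = ?det\<^sup>2 * (mink ?A ?A * mink ?B ?B)"
    unfolding tangent_vector_def
    using ff(2) by (simp add: mink_commute[of ?B ?A] power2_eq_square algebra_simps)
  have "gauss_curvature z u v X Y
      = ?det\<^sup>2 * (- f u * deriv (deriv f) u * ?\<kappa>) / (?det\<^sup>2 * (- \<epsilon> * ((f u)\<^sup>2 * ?\<kappa>)))"
    unfolding gauss_curvature_def Let_def num den ff n12 ..
  also have "\<dots> = deriv (deriv f) u / (\<epsilon> * f u)"
    using \<open>?det \<noteq> 0\<close> nonlightlike[OF assms(2)] f_pos[OF assms(1)] eps
    by (simp add: power2_eq_square)
  also have "\<dots> = \<epsilon> * deriv (deriv f) u / f u"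
    using inverse_unique[OF eps] by (simp add: divide_inverse)
  finally show ?thesis .
qed

lemma flat_iff_deriv2_zero:
  assumes "J \<noteq> {}"
  shows "flat_on z (I \<times> J) \<longleftrightarrow> (\<forall>u\<in>I. deriv (deriv f) u = 0)"
proof
  assume flat: "flat_on z (I \<times> J)"
  obtain v where v: "v \<in> J" using assms by blast
  show "\<forall>u\<in>I. deriv (deriv f) u = 0"
  proof
    fix u assume u: "u \<in> I"
    have frame: "tangent_frame z u v (1, 0) (0, 1)"
      using dim_partials[OF u v] by (simp add: tangent_frame_def tangent_vector_def)
    with flat u v have "gauss_curvature z u v (1, 0) (0, 1) = 0" by (auto simp: flat_on_def)
    then show "deriv (deriv f) u = 0"
      using gauss_curvature_eq[OF u v frame] eps f_pos[OF u] by auto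
  qed
next
  assume "\<forall>u\<in>I. deriv (deriv f) u = 0"
  then show "flat_on z (I \<times> J)" by (auto simp: flat_on_def gauss_curvature_eq)
qed

text \<open>
  The slope of \<open>g\<close> is forced by the normalization, as the reciprocal of \<open>2 \<epsilon> a\<close>. The same equation
  excludes \<open>a = 0\<close>, at any point of \<open>I\<close>.
\<close>

lemma deriv2_zero_iff_affine:
  assumes "is_interval I" "I \<noteq> {}"
  shows "(\<forall>u\<in>I. deriv (deriv f) u = 0) \<longleftrightarrow>
    (\<exists>a b c. a \<noteq> 0 \<and> (\<forall>u\<in>I. f u = a * u + b \<and> g u = \<epsilon> / (2 * a) * u + c))"
proof
  assume "\<forall>u\<in>I. deriv (deriv f) u = 0"
  then have "(deriv f has_real_derivative 0) (at u)" if "u \<in> I" for u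
    using derivs(3)[OF that] that by simp
  from affine_on_interval[OF assms(1) this] obtain a where a: "\<And>u. u \<in> I \<Longrightarrow> deriv f u = a"
    by auto
  have "a \<noteq> 0" using assms(2) a normalized by force
  have "deriv g u = \<epsilon> / (2 * a)" if "u \<in> I" for u
  proof -
    have "2 * a * deriv g u = \<epsilon> * (2 * \<epsilon> * a * deriv g u)" using eps by (simp add: algebra_simps)
    also have "\<dots> = \<epsilon>" using normalized[OF that] a[OF that] by simp
    finally show ?thesis using \<open>a \<noteq> 0\<close> by (simp add: field_simps)
  qed
  then have "(f has_real_derivative a) (at u)"
      "(g has_real_derivative \<epsilon> / (2 * a)) (at u)" if "u \<in> I" for u
    using derivs(1,2)[OF that] a that by simp_all
  from affine_on_interval[OF assms(1) this(1)] affine_on_interval[OF assms(1) this(2)]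
  obtain b c where "\<And>u. u \<in> I \<Longrightarrow> f u = a * u + b" "\<And>u. u \<in> I \<Longrightarrow> g u = \<epsilon> / (2 * a) * u + c"
    by metis
  with \<open>a \<noteq> 0\<close> show "\<exists>a b c. a \<noteq> 0 \<and> (\<forall>u\<in>I. f u = a * u + b \<and> g u = \<epsilon> / (2 * a) * u + c)"
    by blast
next
  assume "\<exists>a b c. a \<noteq> 0 \<and> (\<forall>u\<in>I. f u = a * u + b \<and> g u = \<epsilon> / (2 * a) * u + c)"
  then obtain a b where f: "\<And>u. u \<in> I \<Longrightarrow> f u = a * u + b" by blast
  have f': "deriv f u = a" if "u \<in> I" for u
    using f by (rule deriv_affine_on_open[OF open_I that])
  have "deriv (deriv f) u = 0" if "u \<in> I" for u
    by (rule deriv_affine_on_open[OF open_I that, where b = a]) (simp add: f')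
  then show "\<forall>u\<in>I. deriv (deriv f) u = 0" by blast
qed

section \<open>The ruling of a flat meridian surface\<close>

text \<open>
  The coordinates \<open>(u, v)\<close> are already adapted to the ruling, so that the reparametrization is the
  identity of \<open>I \<times> J\<close>. Along a line, the base point \<open>z u v\<close> moves in the direction \<open>d v\<close>, which lies in
  the plane, and \<open>z\<^sub>v\<close> only changes by the factor \<open>f u\<close>.
\<close>

lemma developable_ruled_if_affine:
  assumes "is_interval J" "a \<noteq> 0"
    and f: "\<And>u. u \<in> I \<Longrightarrow> f u = a * u + b" and g: "\<And>u. u \<in> I \<Longrightarrow> g u = a' * u + c"
  shows "developable_ruled_on z (I \<times> J)"
proof -
  define p where "p = (\<lambda>t. b *\<^sub>R P t + c *\<^sub>R xi1)"
  define d where "d = (\<lambda>t. a *\<^sub>R P t + a' *\<^sub>R xi1)"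
  have smooth: "smooth_on p J" "smooth_on d J"
    unfolding p_def d_def
    by (intro smooth_on_add smooth_on_scaleR smooth_on_const smooth_on_cone_curve open_J smooth_\<phi>)+
  have z: "z s t = p t + s *\<^sub>R d t" if "s \<in> I" for s t
    using f[OF that] g[OF that] by (simp add: meridian_surface_eq p_def d_def algebra_simps)
  have f'g': "deriv f s = a" "deriv g s = a'" if "s \<in> I" for s
    using deriv_affine_on_open[OF open_I that] f g by blast+
  have zu: "du z s t = d t" if "s \<in> I" for s t
    using f'g'[OF that] first_partials(1)[OF that] by (simp add: d_def)
  have zv: "dv z s t = vector_derivative p (at t) + s *\<^sub>R vector_derivative d (at t)"
    if "s \<in> I" "t \<in> J" for s t
  proof -
    have "vector_derivative p (at t) = b *\<^sub>R P' t" "vector_derivative d (at t) = a *\<^sub>R P' t"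
      unfolding p_def d_def using derivs(5)[OF that(2)]
      by (auto intro!: vector_derivative_at derivative_eq_intros)
    then show ?thesis using f[OF that(1)] first_partials(2)[OF that(2)] by (simp add: algebra_simps)
  qed
  have plane: "tangent_plane z s t = (\<lambda>w. p t + w) ` span {d t, P' t}" if "s \<in> I" "t \<in> J" for s t
  proof -
    have *: "(\<exists>k. w = k *\<^sub>R (f s *\<^sub>R P' t)) \<longleftrightarrow> (\<exists>k. w = k *\<^sub>R P' t)" for w
    proof
      assume "\<exists>k. w = k *\<^sub>R P' t"
      then obtain k where "w = k *\<^sub>R P' t" ..
      then have "w = (k / f s) *\<^sub>R (f s *\<^sub>R P' t)" using f_pos[OF that(1)] by simp
      then show "\<exists>k. w = k *\<^sub>R (f s *\<^sub>R P' t)" ..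
    qed auto
    have span: "span {du z s t, dv z s t} = span {d t, P' t}"
      unfolding zu[OF that(1)] first_partials(2)[OF that(2)] span_insert[of "d t"]
      using * by (auto simp: span_singleton image_iff)
    have "tangent_plane z s t = (\<lambda>w. p t + (s *\<^sub>R d t + w)) ` span {d t, P' t}"
      unfolding tangent_plane_def z[OF that(1)] span by (simp add: add.assoc)
    also have "\<dots> = (\<lambda>w. p t + w) ` (\<lambda>w. s *\<^sub>R d t + w) ` span {d t, P' t}"
      by (simp add: image_image)
    also have "(\<lambda>w. s *\<^sub>R d t + w) ` span {d t, P' t} = span {d t, P' t}"
      by (intro translation_of_span span_mul span_base) simp
    finally show ?thesis .
  qed
  have "open J \<and> is_interval J \<and> smooth_on p J \<and> smooth_on d J \<and> (\<forall>t\<in>J. d t \<noteq> 0) \<and>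
      open (I \<times> J) \<and> I \<times> J \<subseteq> UNIV \<times> J \<and> homeomorphism (I \<times> J) (I \<times> J) (\<lambda>x. x) (\<lambda>x. x) \<and>
      (\<forall>(s, t) \<in> I \<times> J. (case (s, t) of (u, v) \<Rightarrow> z u v) = p t + s *\<^sub>R d t) \<and>
      (\<forall>(s, t) \<in> I \<times> J.
        dim {d t, vector_derivative p (at t) + s *\<^sub>R vector_derivative d (at t)} = 2) \<and>
      (\<forall>s s' t. (s, t) \<in> I \<times> J \<and> (s', t) \<in> I \<times> J \<longrightarrow>
        (case (s, t) of (u, v) \<Rightarrow> tangent_plane z u v) =
        (case (s', t) of (u, v) \<Rightarrow> tangent_plane z u v))"
    (is "_ \<and> _ \<and> _ \<and> _ \<and> ?nonzero \<and> _ \<and> _ \<and> ?homeo \<and> ?rule \<and> ?regular \<and> ?plane")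
  proof (intro conjI)
    \<comment> \<open>Pairing with \<open>\<xi>\<^sub>1\<close> detects the slope \<open>a\<close>, since \<open>\<langle>P, \<xi>\<^sub>1\<rangle> = -1\<close>.\<close>
    have "mink (d t) xi1 = - a" for t by (simp add: d_def mink_cone_curve mink_frame)
    with \<open>a \<noteq> 0\<close> show ?nonzero by (metis mink_linear(7) neg_equal_0_iff_equal)
    show ?homeo by (rule homeomorphism_ident)
    show ?rule using z by auto
    show ?regular using dim_partials zu zv by force
    show ?plane using plane by simp
  qed (use assms(1) smooth open_I open_J in \<open>auto simp: open_Times\<close>)
  then show ?thesis unfolding developable_ruled_on_def by blast
qed

end

theorem theorem2:
  fixes f g \<phi> :: "real \<Rightarrow> real" and I J :: "real set" and \<epsilon> :: real
  assumes "open I" "is_interval I" "I \<noteq> {}"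
    and "open J" "is_interval J" "J \<noteq> {}"
    and "smooth_on f I" "smooth_on g I" "smooth_on \<phi> J"
    and "\<forall>u\<in>I. f u > 0"
    and "(\<epsilon> = 1 \<and> (\<forall>v\<in>J. (deriv \<phi> v)\<^sup>2 - (\<phi> v)\<^sup>2 > 0) \<and> (\<forall>u\<in>I. deriv f u * deriv g u > 0)) \<or>
         (\<epsilon> = -1 \<and> (\<forall>v\<in>J. (deriv \<phi> v)\<^sup>2 - (\<phi> v)\<^sup>2 < 0) \<and> (\<forall>u\<in>I. deriv f u * deriv g u < 0))"
    and "\<forall>u\<in>I. 2 * \<epsilon> * deriv f u * deriv g u = 1"
  shows "(flat_on (meridian_surface f g \<phi>) (I \<times> J) \<longleftrightarrow>
           (\<exists>a b c. a \<noteq> 0 \<and> (\<forall>u\<in>I. f u = a * u + b \<and> g u = \<epsilon> / (2 * a) * u + c))) \<and>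
         (flat_on (meridian_surface f g \<phi>) (I \<times> J) \<longrightarrow>
           developable_ruled_on (meridian_surface f g \<phi>) (I \<times> J))"
proof -
  interpret lorentz_meridian_surface f g \<phi> I J \<epsilon>
  proof
    show "\<epsilon> * \<epsilon> = 1" using assms(11) by auto
    show "(deriv \<phi> v)\<^sup>2 - (\<phi> v)\<^sup>2 \<noteq> 0" if "v \<in> J" for v using assms(11) that by force
  qed (use assms in auto)
  have flat: "flat_on z (I \<times> J) \<longleftrightarrow>
      (\<exists>a b c. a \<noteq> 0 \<and> (\<forall>u\<in>I. f u = a * u + b \<and> g u = \<epsilon> / (2 * a) * u + c))"
    using flat_iff_deriv2_zero[OF \<open>J \<noteq> {}\<close>]
      deriv2_zero_iff_affine[OF \<open>is_interval I\<close> \<open>I \<noteq> {}\<close>] by simp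
  moreover have "developable_ruled_on z (I \<times> J)" if "flat_on z (I \<times> J)"
  proof -
    from that flat obtain a b c where "a \<noteq> 0"
      and "\<And>u. u \<in> I \<Longrightarrow> f u = a * u + b" "\<And>u. u \<in> I \<Longrightarrow> g u = \<epsilon> / (2 * a) * u + c"
      by blast
    then show ?thesis by (rule developable_ruled_if_affine[OF \<open>is_interval J\<close>])
  qed
  ultimately show ?thesis by blast
qed

end
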